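(* Let $V$ be a valuation ring of rank one with quotient field $K$ and with uncountable residue field. Then $\mathrm{Zar}(K(X)|V)^{\mathrm{cons}}$ is not metrizable.
   Context: $\mathrm{Zar}(K(X)|V)$ is the set of valuation domains of $K(X)$ (with quotient field $K(X)$) containing $V$. For $\phi\in K(X)$ let $B(\phi)=\{W\in\mathrm{Zar}(K(X)|V)\mid\phi\in W\}$. $\mathrm{Zar}(K(X)|V)^{\mathrm{cons}}$ is this set endowed with the constructible topology, i.e., the coarsest topology for which all sets $B(\phi_1)\cap\cdots\cap B(\phi_k)$ are both open and closed. *)

theory Defs
  imports
    "HOL-Analysis.Abstract_Metric_Spaces"
    "HOL-Library.Extended_Nat"
    "HOL-Computational_Algebra.Polynomial_Factorial"
    "HOL-Algebra.Algebraic_Closure_Type"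
begin

text \<open>
  Fields are types of class \<open>field\<close>; the field of rational functions over \<open>'a\<close> is
  \<open>'a poly fract\<close>. Subrings of a field are sets, and ideal theory in a subring \<open>V\<close> is that of
  HOL-Algebra, applied to the following ring.
\<close>

abbreviation ring_on :: "'a::field set \<Rightarrow> 'a ring" where
  "ring_on V \<equiv> ring_of_type_algebra\<lparr>carrier := V\<rparr>"

text \<open>
  Valuation domains with quotient field the whole type. The second conjunct already forces every
  element of the type to be a quotient of elements of \<open>V\<close>. The field itself (the trivial
  valuation domain) is included.
\<close>

definition valuation_domain :: "'a::field set \<Rightarrow> bool" where
  "valuation_domain V \<longleftrightarrow>
     subring V ring_of_type_algebra \<and> (\<forall>x. x \<noteq> 0 \<longrightarrow> x \<in> V \<or> inverse x \<in> V)"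

text \<open>
  The Krull dimension, that is, the supremum of the lengths \<open>n\<close> of chains
  \<open>P 0 \<subset> P 1 \<subset> \<dots> \<subset> P n\<close> of prime ideals. For a valuation domain this is its rank.
\<close>

definition krull_dim :: "('a, 'b) ring_scheme \<Rightarrow> enat" where
  "krull_dim R =
     Sup {enat n | n. \<exists>P. (\<forall>i\<le>n. primeideal (P i) R) \<and> (\<forall>i<n. P i \<subset> P (Suc i))}"

definition const_ratfun :: "'a::field \<Rightarrow> 'a poly fract" where
  "const_ratfun c = to_fract [:c:]"

definition Zar :: "'b::field set \<Rightarrow> 'b set set" where
  "Zar D = {W. valuation_domain W \<and> D \<subseteq> W}"

definition Zar_B :: "'b::field set \<Rightarrow> 'b \<Rightarrow> 'b set set" where
  "Zar_B D \<phi> = {W \<in> Zar D. \<phi> \<in> W}"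

definition Zar_basic :: "'b::field set \<Rightarrow> 'b set set set" where
  "Zar_basic D = {\<Inter>\<phi>\<in>F. Zar_B D \<phi> | F. finite F \<and> F \<noteq> {}}"

definition Zar_cons :: "'b::field set \<Rightarrow> 'b set topology" where
  "Zar_cons D = topology_generated_by (Zar_basic D \<union> (\<lambda>U. Zar D - U) ` Zar_basic D)"

lemma Zar_basic_subset: "U \<in> Zar_basic D \<Longrightarrow> U \<subseteq> Zar D"
  by (auto simp: Zar_basic_def Zar_B_def)

lemma topspace_Zar_cons: "topspace (Zar_cons D) = Zar D"
proof -
  have "Zar_B D 0 \<in> Zar_basic D"
    unfolding Zar_basic_def by (rule CollectI, rule exI[of _ "{0}"]) simp
  then show ?thesis
    using Zar_basic_subset unfolding Zar_cons_def by fastforce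
qed

lemma Zar_cons_clopen:
  assumes "U \<in> Zar_basic D"
  shows "openin (Zar_cons D) U" and "closedin (Zar_cons D) U"
proof -
  show "openin (Zar_cons D) U"
    unfolding Zar_cons_def by (rule topology_generated_by_Basis) (use assms in blast)
  have "openin (Zar_cons D) (Zar D - U)"
    unfolding Zar_cons_def by (rule topology_generated_by_Basis) (use assms in blast)
  then show "closedin (Zar_cons D) U"
    using Zar_basic_subset[OF assms] by (simp add: closedin_def topspace_Zar_cons)
qed

lemma Zar_cons_coarsest:
  assumes T: "topspace T = Zar D"
    and clopen: "\<And>U. U \<in> Zar_basic D \<Longrightarrow> openin T U \<and> closedin T U"
    and "openin (Zar_cons D) S"
  shows "openin T S"
proof -
  have "generate_topology_on (Zar_basic D \<union> (\<lambda>U. Zar D - U) ` Zar_basic D) S"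
    using assms(3) by (simp add: Zar_cons_def openin_topology_generated_by_iff)
  then show ?thesis
  proof induction
    case (Basis s)
    then show ?case
      using clopen T by (auto simp: closedin_def)
  qed auto
qed

end

theory Submission
  imports Defs
begin

text \<open>
  In a metrizable topology every point is the intersection of countably many open sets, so a point
  \<open>G\<close> of \<open>Zar_cons D\<close> would be determined among all points by its intersection with some countable
  set \<open>C\<close> of rational functions. Let \<open>G\<close> be the Gauss extension of \<open>V\<close>, whose residue field is
  \<open>k(t)\<close> with \<open>k\<close> the residue field of \<open>V\<close>. For \<open>a \<in> V\<close> let \<open>W\<^sub>a \<subset> G\<close> be the preimage in \<open>G\<close> of
  the local ring of \<open>k(t)\<close> at the residue of \<open>a\<close>. Each element of \<open>G\<close> lies outside \<open>W\<^sub>a\<close> for only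
  finitely many residues of \<open>a\<close>, because its reduction has finitely many poles. As \<open>k\<close> is
  uncountable, some \<open>W\<^sub>a \<noteq> G\<close> meets \<open>C\<close> in the same set as \<open>G\<close>.
\<close>

section \<open>Valuation domains in a field and in a field of fractions\<close>

lemma valuation_domain_iff:
  fixes V :: "'a::field set"
  shows "valuation_domain V \<longleftrightarrow>
    1 \<in> V \<and> (\<forall>x\<in>V. \<forall>y\<in>V. x - y \<in> V) \<and> (\<forall>x\<in>V. \<forall>y\<in>V. x * y \<in> V) \<and>
    (\<forall>x. x \<noteq> 0 \<longrightarrow> x \<in> V \<or> inverse x \<in> V)"
    (is "_ \<longleftrightarrow> ?R")
proof -
  interpret K: ring "ring_of_type_algebra :: 'a ring" ..
  have uminus: "\<ominus>\<^bsub>ring_of_type_algebra\<^esub> x = - x" for x :: 'a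
    by (rule K.minus_equality) (auto simp: ring_of_type_algebra_def)
  show ?thesis
  proof
    assume V: "valuation_domain V"
    then have V': "subring V ring_of_type_algebra"
      by (simp add: valuation_domain_def)
    have "1 \<in> V" "\<And>x. x \<in> V \<Longrightarrow> - x \<in> V" "\<And>x y. x \<in> V \<Longrightarrow> y \<in> V \<Longrightarrow> x * y \<in> V"
      and add: "\<And>x y. x \<in> V \<Longrightarrow> y \<in> V \<Longrightarrow> x + y \<in> V"
      using subringE(3,5,6,7)[OF V', unfolded uminus] by (auto simp: ring_of_type_algebra_def)
    moreover from this have "x - y \<in> V" if "x \<in> V" "y \<in> V" for x y
      using add[of x "- y"] that by auto
    ultimately show ?R
      using V by (auto simp: valuation_domain_def)
  next
    assume R: ?R
    then have zero: "0 \<in> V"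
      by (metis diff_self)
    with R have minus: "- x \<in> V" if "x \<in> V" for x
      using that by (metis diff_0)
    with R have "x + y \<in> V" if "x \<in> V" "y \<in> V" for x y
      using that by (metis diff_minus_eq_add)
    with R minus have "subring V ring_of_type_algebra"
      by (intro K.subringI) (auto simp: uminus, auto simp: ring_of_type_algebra_def)
    with R show "valuation_domain V"
      by (simp add: valuation_domain_def)
  qed
qed

text \<open>Here \<open>R f h\<close> stands for divisibility of \<open>f\<close> by
  \<open>h\<close> in the ring to be built. Cancellation makes it independent of the chosen
  fraction, so each ring axiom can be checked on numerators and denominators.\<close>

lemma valuation_domain_fractions:
  fixes R :: "'p::idom \<Rightarrow> 'p \<Rightarrow> bool"
  assumes nz: "\<And>f h. R f h \<Longrightarrow> h \<noteq> 0"
    and cancel: "\<And>f g h. g \<noteq> 0 \<Longrightarrow> h \<noteq> 0 \<Longrightarrow> R (f * g) (h * g) \<longleftrightarrow> R f h"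
    and diff: "\<And>f g h. R f h \<Longrightarrow> R g h \<Longrightarrow> R (f - g) h"
    and trans: "\<And>f g h. R f g \<Longrightarrow> R g h \<Longrightarrow> R f h"
    and total: "\<And>f h. f \<noteq> 0 \<Longrightarrow> h \<noteq> 0 \<Longrightarrow> R f h \<or> R h f"
  defines "W \<equiv> {Fract f h | f h. R f h}"
  shows "valuation_domain W"
    and "h \<noteq> 0 \<Longrightarrow> Fract f h \<in> W \<longleftrightarrow> R f h"
proof -
  have mem: "Fract f h \<in> W \<longleftrightarrow> R f h" if h: "h \<noteq> 0" for f h
  proof
    assume "Fract f h \<in> W"
    then obtain f' h' where *: "Fract f h = Fract f' h'" "R f' h'"
      by (auto simp: W_def)
    then have h': "h' \<noteq> 0"
      using nz by blast
    have "R (f' * h) (h' * h)"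
      using cancel[of h h' f'] h h' * by simp
    also have "f' * h = f * h'"
      using * h h' by (simp add: eq_fract)
    finally show "R f h"
      using cancel[of h' h f] h h' by (simp add: mult.commute)
  qed (auto simp: W_def)
  then show "h \<noteq> 0 \<Longrightarrow> Fract f h \<in> W \<longleftrightarrow> R f h" .
  have refl: "R h h" if "h \<noteq> 0" for h
    using total[OF that that] by simp
  show "valuation_domain W"
    unfolding valuation_domain_iff
  proof (intro conjI ballI allI impI)
    show "1 \<in> W"
      using mem[of 1 1] refl[of 1] by (simp add: One_fract_def)
  next
    fix x y assume "x \<in> W" "y \<in> W"
    then obtain f h g k where x: "x = Fract f h" "R f h" and y: "y = Fract g k" "R g k"
      by (auto simp: W_def)
    have hk: "h \<noteq> 0" "k \<noteq> 0"
      using nz x y by auto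
    have fk: "R (f * k) (h * k)"
      using cancel x hk by simp
    have gh: "R (g * h) (h * k)"
      using cancel[of h k g] y hk by (simp add: mult.commute)
    have "R (f * k - g * h) (h * k)"
      using diff fk gh by blast
    then show "x - y \<in> W"
      using mem[of "h * k"] hk x y by (simp add: mult.commute)
    \<comment> \<open>The middle term for \<open>trans\<close> is \<open>h * g\<close>. The case
      \<open>g = 0\<close> is separate because \<open>cancel\<close> asks for a nonzero factor;
      there 0 arises as the difference of \<open>f * k\<close> with itself.\<close>
    have "R (f * g) (h * k)"
    proof (cases "g = 0")
      case True
      with diff[OF fk fk] show ?thesis by simp
    next
      case False
      then have "R (f * g) (h * g)" using cancel x hk by simp
      with gh show ?thesis using trans by (metis mult.commute)
    qed
    then show "x * y \<in> W"
      using mem[of "h * k"] hk x y by simp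
  next
    fix x :: "'p fract" assume "x \<noteq> 0"
    then obtain f h where x: "x = Fract f h" "h \<noteq> 0" "f \<noteq> 0"
      by (cases x rule: Fract_cases_nonzero) auto
    then show "x \<in> W \<or> inverse x \<in> W"
      using total[of f h] mem[of h f] mem[of f h] by auto
  qed
qed

section \<open>Neighbourhoods and countable separation in the constructible topology\<close>

text \<open>A subbasic set or its complement tests membership of finitely many functions, and finite
  intersections and arbitrary unions preserve this local finiteness around \<open>G\<close>.\<close>

lemma Zar_cons_local_finite:
  assumes "openin (Zar_cons D) U" "G \<in> U"
  shows "\<exists>F. finite F \<and> (\<forall>W\<in>Zar D. W \<inter> F = G \<inter> F \<longrightarrow> W \<in> U)"
proof -
  have "generate_topology_on (Zar_basic D \<union> (\<lambda>U. Zar D - U) ` Zar_basic D) U"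
    using assms(1) by (simp add: Zar_cons_def openin_topology_generated_by_iff)
  then show ?thesis
    using assms(2)
  proof induction
    case Empty
    then show ?case by simp
  next
    case (Int a b)
    then obtain F F' where "finite F" "\<forall>W\<in>Zar D. W \<inter> F = G \<inter> F \<longrightarrow> W \<in> a"
      "finite F'" "\<forall>W\<in>Zar D. W \<inter> F' = G \<inter> F' \<longrightarrow> W \<in> b"
      by auto
    then show ?case
      by (intro exI[of _ "F \<union> F'"]) blast
  next
    case (UN K)
    then obtain k where "k \<in> K" "G \<in> k"
      by blast
    with UN(2)[of k] show ?case
      by (meson UnionI)
  next
    case (Basis s)
    then obtain F where F: "finite F" "F \<noteq> {}"
      and s: "s = (\<Inter>\<phi>\<in>F. Zar_B D \<phi>) \<or> s = Zar D - (\<Inter>\<phi>\<in>F. Zar_B D \<phi>)"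
      unfolding Zar_basic_def by blast
    \<comment> \<open>Since \<open>F\<close> is nonempty, the intersection stays inside
      \<open>Zar D\<close>.\<close>
    have "(\<Inter>\<phi>\<in>F. Zar_B D \<phi>) = {W \<in> Zar D. F \<subseteq> W}"
      using F by (auto simp: Zar_B_def)
    with s Basis(2) F show ?case
      by (intro exI[of _ F]) auto
  qed
qed

text \<open>In a metrizable space points are closed and closed sets are countable intersections of
  open sets. Each of these open sets contributes a finite set of test functions; \<open>C\<close> is
  their union.\<close>

lemma metrizable_Zar_cons_countable_separation:
  assumes "metrizable_space (Zar_cons D)" "G \<in> Zar D"
  shows "\<exists>C. countable C \<and> (\<forall>W\<in>Zar D. W \<inter> C = G \<inter> C \<longrightarrow> W = G)"
proof -
  have "closedin (Zar_cons D) {G}"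
    using metrizable_imp_t1_space[OF assms(1)] assms(2)
    by (simp add: t1_space_closedin_singleton topspace_Zar_cons)
  then have "gdelta_in (Zar_cons D) {G}"
    using closed_imp_gdelta_in assms(1) by blast
  then obtain T where "(countable intersection_of openin (Zar_cons D)) T" "Zar D \<inter> T = {G}"
    unfolding gdelta_in_def relative_to_def topspace_Zar_cons by blast
  then obtain \<U> where \<U>: "countable \<U>" "\<U> \<subseteq> Collect (openin (Zar_cons D))" "\<Inter>\<U> = T"
    unfolding intersection_of_def by metis
  have eq: "{G} = Zar D \<inter> \<Inter>\<U>"
    by (simp only: \<U>(3) \<open>Zar D \<inter> T = {G}\<close>)
  have "\<forall>U\<in>\<U>. \<exists>F. finite F \<and> (\<forall>W\<in>Zar D. W \<inter> F = G \<inter> F \<longrightarrow> W \<in> U)"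
  proof
    fix U assume "U \<in> \<U>"
    moreover from this have "G \<in> U"
      using eq by auto
    ultimately show "\<exists>F. finite F \<and> (\<forall>W\<in>Zar D. W \<inter> F = G \<inter> F \<longrightarrow> W \<in> U)"
      using \<U>(2) by (intro Zar_cons_local_finite) auto
  qed
  then obtain F where F: "\<And>U. U \<in> \<U> \<Longrightarrow> finite (F U)"
    "\<And>U W. U \<in> \<U> \<Longrightarrow> W \<in> Zar D \<Longrightarrow> W \<inter> F U = G \<inter> F U \<Longrightarrow> W \<in> U"
    by metis
  show ?thesis
  proof (intro exI[of _ "\<Union>U\<in>\<U>. F U"] conjI ballI impI)
    show "countable (\<Union>U\<in>\<U>. F U)"
      using \<U>(1) F(1) by (simp add: countable_finite)
    fix W assume W: "W \<in> Zar D" "W \<inter> (\<Union>U\<in>\<U>. F U) = G \<inter> (\<Union>U\<in>\<U>. F U)"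
    have "W \<in> U" if "U \<in> \<U>" for U
      using that W by (intro F(2)[of U W]) blast+
    with W(1) eq show "W = G" by blast
  qed
qed

section \<open>Units, nonunits and residues of a valuation ring\<close>

locale valuation_ring =
  fixes V :: "'a::field set"
  assumes valuation_domain: "valuation_domain V"
begin

lemma one_mem: "1 \<in> V"
  and diff_mem: "x \<in> V \<Longrightarrow> y \<in> V \<Longrightarrow> x - y \<in> V"
  and mult_mem: "x \<in> V \<Longrightarrow> y \<in> V \<Longrightarrow> x * y \<in> V"
  and total: "x \<noteq> 0 \<Longrightarrow> x \<in> V \<or> inverse x \<in> V"
  using valuation_domain by (auto simp: valuation_domain_iff)

lemma zero_mem: "0 \<in> V"
  using diff_mem[OF one_mem one_mem] by simp

lemma uminus_mem: "x \<in> V \<Longrightarrow> - x \<in> V"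
  using diff_mem[OF zero_mem] by fastforce

lemma add_mem: "x \<in> V \<Longrightarrow> y \<in> V \<Longrightarrow> x + y \<in> V"
  using diff_mem[of x "- y"] uminus_mem by simp

lemma sum_mem: "(\<And>i. i \<in> I \<Longrightarrow> f i \<in> V) \<Longrightarrow> sum f I \<in> V"
  by (induction I rule: infinite_finite_induct) (auto intro: zero_mem add_mem)

text \<open>This is the maximal ideal of \<open>V\<close>. Zero is listed explicitly because
  \<open>inverse 0 = 0\<close> lies in \<open>V\<close>.\<close>

definition nonunits :: "'a set" where
  "nonunits = {x \<in> V. x = 0 \<or> inverse x \<notin> V}"

lemma nonunits_mem: "x \<in> nonunits \<Longrightarrow> x \<in> V"
  and zero_nonunits: "0 \<in> nonunits"
  and one_nonunits: "1 \<notin> nonunits"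
  by (auto simp: nonunits_def zero_mem one_mem)

lemma nonunits_mult:
  assumes "x \<in> nonunits" "y \<in> V"
  shows "x * y \<in> nonunits" "y * x \<in> nonunits"
proof -
  have "inverse x \<in> V" if "inverse (x * y) \<in> V" "x * y \<noteq> 0"
    using mult_mem[OF that(1) assms(2)] that(2) by (simp add: field_simps)
  then show "x * y \<in> nonunits"
    using assms by (auto simp: nonunits_def mult_mem)
  then show "y * x \<in> nonunits"
    by (simp add: mult.commute)
qed

lemma nonunits_prime:
  assumes "x \<in> V" "y \<in> V" "x * y \<in> nonunits"
  shows "x \<in> nonunits \<or> y \<in> nonunits"
  using assms mult_mem[of "inverse x" "inverse y"]
  by (auto simp: nonunits_def)

text \<open>Of two nonzero elements one divides the other, so the sum is a multiple of a
  nonunit.\<close>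

lemma nonunits_add:
  assumes "x \<in> nonunits" "y \<in> nonunits"
  shows "x + y \<in> nonunits"
proof -
  have *: "x + y \<in> nonunits" if "x \<in> nonunits" "x \<noteq> 0" "y / x \<in> V" for x y
  proof -
    have "x + y = x * (1 + y / x)"
      using that by (simp add: field_simps)
    then show ?thesis
      using that nonunits_mult add_mem one_mem by metis
  qed
  show ?thesis
  proof (cases "x = 0 \<or> y = 0")
    case False
    then have "y / x \<in> V \<or> x / y \<in> V"
      using total[of "y / x"] by (simp add: inverse_eq_divide)
    then show ?thesis
      using *[of x y] *[of y x] False assms by (auto simp: add.commute)
  qed (use assms in auto)
qed

lemma nonunits_uminus: "x \<in> nonunits \<Longrightarrow> - x \<in> nonunits"
  using nonunits_mult(1)[of x "- 1"] uminus_mem one_mem by simp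

lemma nonunits_diff: "x \<in> nonunits \<Longrightarrow> y \<in> nonunits \<Longrightarrow> x - y \<in> nonunits"
  using nonunits_add[of x "- y"] nonunits_uminus by simp

lemma nonunits_sum: "(\<And>i. i \<in> I \<Longrightarrow> f i \<in> nonunits) \<Longrightarrow> sum f I \<in> nonunits"
  by (induction I rule: infinite_finite_induct) (auto intro: zero_nonunits nonunits_add)

lemma unit_inverse: "x \<in> V \<Longrightarrow> x \<notin> nonunits \<Longrightarrow> inverse x \<in> V \<and> inverse x \<notin> nonunits"
  by (auto simp: nonunits_def)

lemma nonunits_mult_unit_iff:
  assumes "u \<in> V" "u \<notin> nonunits"
  shows "x * u \<in> nonunits \<longleftrightarrow> x \<in> nonunits" "x * u \<in> V \<longleftrightarrow> x \<in> V"
proof -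
  have "x * u * inverse u = x"
    using assms zero_nonunits by (auto simp: field_simps)
  then show "x * u \<in> nonunits \<longleftrightarrow> x \<in> nonunits" "x * u \<in> V \<longleftrightarrow> x \<in> V"
    using assms unit_inverse nonunits_mult(1) mult_mem by metis+
qed

lemma ring_ring_on: "ring (ring_on V)"
proof -
  interpret K: ring "ring_of_type_algebra :: 'a ring" ..
  show ?thesis
    using K.subring_is_ring valuation_domain by (simp add: valuation_domain_def)
qed

lemma ideal_nonunits: "ideal nonunits (ring_on V)"
proof (rule idealI[OF ring_ring_on])
  interpret ring "ring_on V"
    by (rule ring_ring_on)
  have "\<ominus>\<^bsub>ring_on V\<^esub> x = - x" if "x \<in> V" for x
    using that uminus_mem by (intro minus_equality) (auto simp: ring_of_type_algebra_def)
  then show "subgroup nonunits (add_monoid (ring_on V))"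
    using nonunits_add nonunits_uminus nonunits_mem zero_nonunits
    by (intro add.subgroupI) (auto simp: a_inv_def[symmetric], auto simp: ring_of_type_algebra_def)
qed (auto simp: ring_of_type_algebra_def nonunits_mult)

text \<open>This ties the abstract ideal to the concrete set of nonunits. A unit in \<open>M\<close>
  would give \<open>M = V\<close>, so \<open>M\<close> lies in the proper ideal
  \<open>nonunits\<close>, and maximality forces equality.\<close>

lemma maximalideal_unique:
  assumes "maximalideal M (ring_on V)"
  shows "M = nonunits"
proof -
  interpret maximalideal M "ring_on V" by fact
  have M: "M \<subseteq> V"
    using a_subset by simp
  have "x \<in> nonunits" if x: "x \<in> M" for x
  proof (rule ccontr)
    assume "x \<notin> nonunits"
    then have x': "x \<noteq> 0" "inverse x \<in> V"
      using x M by (auto simp: nonunits_def)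
    have "y \<in> M" if "y \<in> V" for y
    proof -
      have "x * (inverse x * y) \<in> M"
        using I_r_closed[OF x, of "inverse x * y"] x' that mult_mem
        by (simp add: ring_of_type_algebra_def)
      then show ?thesis
        using x' by (simp add: field_simps)
    qed
    then show False
      using M I_notcarr by auto
  qed
  then have "M \<subseteq> nonunits" "nonunits \<subseteq> V"
    by (auto simp: nonunits_mem)
  then have "nonunits = M \<or> nonunits = V"
    using I_maximal[OF ideal_nonunits] by simp
  then show ?thesis
    using one_mem one_nonunits by auto
qed

lemma ex_uncountable_incongruent:
  assumes "maximalideal M (ring_on V)" "uncountable (carrier (ring_on V Quot M))"
  obtains A where "A \<subseteq> V" "uncountable A"
    "\<And>a b. a \<in> A \<Longrightarrow> b \<in> A \<Longrightarrow> a \<noteq> b \<Longrightarrow> a - b \<notin> nonunits"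
proof -
  define coset where "coset x = (\<lambda>m. m + x) ` nonunits" for x
  have carrier: "carrier (ring_on V Quot M) = coset ` V"
    by (auto simp: FactRing_def A_RCOSETS_def' a_r_coset_def' coset_def
        maximalideal_unique[OF assms(1)] ring_of_type_algebra_def)
  have coset_eq: "coset a = coset b" if "a - b \<in> nonunits" for a b
  proof -
    have sub: "coset a \<subseteq> coset b" if ab: "a - b \<in> nonunits" for a b
    proof
      fix z assume "z \<in> coset a"
      then obtain m where "m \<in> nonunits" "z = m + a" by (auto simp: coset_def)
      then have "m + (a - b) \<in> nonunits" "z = (m + (a - b)) + b"
        using ab nonunits_add by auto
      then show "z \<in> coset b" unfolding coset_def by blast
    qed
    then show ?thesis
      using that nonunits_uminus[OF that] by (auto simp: subset_antisym)
  qed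
  \<comment> \<open>One representative is chosen from each residue class.\<close>
  define A where "A = inv_into V coset ` coset ` V"
  show thesis
  proof (rule that)
    show "A \<subseteq> V"
      by (auto simp: A_def inv_into_into)
    have inj: "inj_on (inv_into V coset) (coset ` V)"
      by (rule inj_on_inv_into) simp
    show "uncountable A"
      using assms(2) countable_image_inj_on[OF _ inj] by (auto simp: A_def carrier)
    show "a - b \<notin> nonunits" if ab: "a \<in> A" "b \<in> A" "a \<noteq> b" for a b
    proof
      assume "a - b \<in> nonunits"
      with coset_eq have "coset a = coset b" .
      moreover have "inv_into V coset (coset c) = c" if "c \<in> A" for c
        using that by (auto simp: A_def f_inv_into_f)
      ultimately show False
        using ab by metis
    qed
  qed
qed

section \<open>Polynomials over the valuation ring and roots of their reductions\<close>

definition integral :: "'a poly \<Rightarrow> bool" where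
  "integral p \<longleftrightarrow> (\<forall>i. coeff p i \<in> V)"

lemma integral_add: "integral p \<Longrightarrow> integral q \<Longrightarrow> integral (p + q)"
  and integral_mult: "integral p \<Longrightarrow> integral q \<Longrightarrow> integral (p * q)"
  and integral_pCons: "integral (pCons a p) \<longleftrightarrow> a \<in> V \<and> integral p"
  and integral_0: "integral 0"
  by (auto simp: integral_def add_mem coeff_mult sum_mem mult_mem coeff_pCons zero_mem
      split: nat.splits)

lemma integral_pcompose: "integral p \<Longrightarrow> integral q \<Longrightarrow> integral (pcompose p q)"
  by (induction p)
    (auto simp: pcompose_pCons integral_pCons integral_0 intro!: integral_add integral_mult)

lemma poly_mem: "integral p \<Longrightarrow> a \<in> V \<Longrightarrow> poly p a \<in> V"
  by (induction p) (auto simp: integral_pCons zero_mem intro!: add_mem mult_mem)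

lemma integral_synthetic_div: "integral p \<Longrightarrow> a \<in> V \<Longrightarrow> integral (synthetic_div p a)"
  by (induction p) (auto simp: integral_pCons integral_0 intro: poly_mem)

text \<open>This is the bound on the number of roots over the residue field, stated upstairs: more
  incongruent roots of the reduction than the degree make the reduction zero. The induction splits
  off one linear factor at a time.\<close>

lemma coeffs_nonunits_if_many_roots:
  assumes "integral p" "B \<subseteq> V" "finite B" "card B > degree p"
    and "\<And>a b. a \<in> B \<Longrightarrow> b \<in> B \<Longrightarrow> a \<noteq> b \<Longrightarrow> a - b \<notin> nonunits"
    and "\<And>a. a \<in> B \<Longrightarrow> poly p a \<in> nonunits"
  shows "coeff p i \<in> nonunits"
  using assms
proof (induction "degree p" arbitrary: p B i)
  case 0
  then obtain c where p: "p = [:c:]"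
    using degree_0_id by metis
  from 0 obtain b where "b \<in> B"
    by fastforce
  with 0 have "c \<in> nonunits"
    by (auto simp: p)
  then show ?case
    by (simp add: p coeff_pCons zero_nonunits split: nat.splits)
next
  case (Suc n)
  then obtain a where a: "a \<in> B"
    by fastforce
  define q where "q = synthetic_div p a"
  \<comment> \<open>The remainder is a nonunit rather than zero, so it has to be carried
    along.\<close>
  have p: "p = [:- a, 1:] * q + [:poly p a:]"
    by (simp only: q_def synthetic_div_correct')
  have aV: "a \<in> V"
    using a Suc.prems by auto
  have deg: "n = degree q"
    using Suc.hyps(2) by (simp add: q_def degree_synthetic_div)
  have int: "integral q"
    using integral_synthetic_div Suc.prems aV by (simp add: q_def)
  \<comment> \<open>Modulo nonunits \<open>b\<close> is a root of \<open>(X - a) * q\<close>, and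
    \<open>b - a\<close> is a unit, so by primality \<open>b\<close> is a root of
    \<open>q\<close>.\<close>
  have root: "poly q b \<in> nonunits" if b: "b \<in> B - {a}" for b
  proof -
    have "poly p b = (b - a) * poly q b + poly p a"
      by (subst p) (simp add: algebra_simps)
    then have "(b - a) * poly q b = poly p b - poly p a"
      by simp
    moreover have "poly p b - poly p a \<in> nonunits"
      using Suc.prems(6) a b by (intro nonunits_diff) auto
    ultimately have "(b - a) * poly q b \<in> nonunits"
      by simp
    then show ?thesis
      using nonunits_prime[of "b - a" "poly q b"] Suc.prems(5)[of b a] a b
        diff_mem[of b a] poly_mem[OF int, of b] Suc.prems(2) by blast
  qed
  have q: "coeff q j \<in> nonunits" for j
  proof (rule Suc.hyps(1)[OF deg int])
    show "card (B - {a}) > degree q"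
      using Suc.prems(3,4) a Suc.hyps(2) deg by simp
  qed (use root Suc.prems in auto)
  have "coeff p i = - a * coeff q i + (case i of 0 \<Rightarrow> 0 | Suc j \<Rightarrow> coeff q j)
      + coeff [:poly p a:] i"
    by (subst p) (simp add: coeff_pCons split: nat.splits)
  moreover have "coeff [:poly p a:] i \<in> nonunits"
    using Suc.prems(6)[OF a] by (simp add: coeff_pCons zero_nonunits split: nat.splits)
  moreover have "- a * coeff q i \<in> nonunits"
    using q aV by (intro nonunits_mult uminus_mem)
  moreover have "(case i of 0 \<Rightarrow> 0 | Suc j \<Rightarrow> coeff q j) \<in> nonunits"
    using q by (simp add: zero_nonunits split: nat.splits)
  ultimately show ?case
    by (metis nonunits_add)
qed

section \<open>Least coefficients and Gauss's lemma\<close>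

text \<open>The coefficient of least value, of smallest index if there are several.\<close>

definition lead :: "'a poly \<Rightarrow> nat \<Rightarrow> bool" where
  "lead f i \<longleftrightarrow> coeff f i \<noteq> 0 \<and> (\<forall>j. coeff f j / coeff f i \<in> V) \<and>
     (\<forall>j<i. coeff f j / coeff f i \<in> nonunits)"

text \<open>Finitely many values have a minimum; no value group is formed, so the minimum is
  expressed by divisibility.\<close>

lemma ex_generator:
  assumes "finite S" "\<exists>c\<in>S. c \<noteq> 0"
  shows "\<exists>c\<in>S. c \<noteq> 0 \<and> (\<forall>d\<in>S. d / c \<in> V)"
  using assms
proof induction
  case (insert x S)
  show ?case
  proof (cases "\<exists>c\<in>S. c \<noteq> 0")
    case False
    with insert show ?thesis
      using one_mem zero_mem by fastforce
  next
    case True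
    with insert obtain c where c: "c \<in> S" "c \<noteq> 0" "\<And>d. d \<in> S \<Longrightarrow> d / c \<in> V"
      by auto
    show ?thesis
    proof (cases "x / c \<in> V")
      case True
      with c show ?thesis by auto
    next
      case False
      then have "x / c \<noteq> 0"
        using zero_mem by metis
      with False total[of "x / c"] have x: "x \<noteq> 0" "c / x \<in> V"
        by auto
      have "d / x \<in> V" if "d \<in> S" for d
        using mult_mem[OF c(3)[OF that] x(2)] c by simp
      with x show ?thesis
        using one_mem by auto
    qed
  qed
qed simp

text \<open>Take the first index whose coefficient divides all others. If an earlier coefficient
  were a unit multiple of this one, its index would qualify too.\<close>

lemma ex_lead:
  assumes "f \<noteq> 0"
  shows "\<exists>i. lead f i"
proof -
  define P where "P i \<longleftrightarrow> coeff f i \<noteq> 0 \<and> (\<forall>j. coeff f j / coeff f i \<in> V)" for i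
  have "finite (range (coeff f))"
  proof (rule finite_subset)
    show "range (coeff f) \<subseteq> insert 0 (coeff f ` {..degree f})"
      by (auto simp: image_iff) (metis atMost_iff coeff_eq_0 not_le)
  qed simp
  then have "\<exists>c\<in>range (coeff f). c \<noteq> 0 \<and> (\<forall>d\<in>range (coeff f). d / c \<in> V)"
    using assms by (intro ex_generator) (auto simp: poly_eq_iff)
  then obtain k where "P k"
    by (auto simp: P_def)
  then have P: "P (Least P)"
    by (rule LeastI)
  have "coeff f j / coeff f (Least P) \<in> nonunits" if "j < Least P" for j
  proof (rule ccontr)
    assume j: "coeff f j / coeff f (Least P) \<notin> nonunits"
    with P have nz: "coeff f j \<noteq> 0" and inv: "coeff f (Least P) / coeff f j \<in> V"
      by (auto simp: nonunits_def P_def)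
    have "coeff f k / coeff f j \<in> V" for k
    proof -
      have "coeff f k / coeff f (Least P) * (coeff f (Least P) / coeff f j) \<in> V"
        using P inv by (intro mult_mem) (auto simp: P_def)
      then show ?thesis
        using P by (simp add: P_def)
    qed
    with nz have "P j"
      by (simp add: P_def)
    with that show False
      using not_less_Least by blast
  qed
  with P show ?thesis
    by (auto simp: lead_def P_def)
qed

lemma lead_nonzero: "lead f i \<Longrightarrow> f \<noteq> 0"
  by (auto simp: lead_def)

lemma lead_unique:
  assumes "lead f i" "lead f j"
  shows "i = j"
proof -
  have False if "lead f i" "lead f j" "i < j" for i j
  proof -
    have "coeff f i / coeff f j \<in> nonunits" "coeff f j / coeff f i \<in> V"
      using that by (auto simp: lead_def)
    then show False
      using that by (auto simp: nonunits_def lead_def)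
  qed
  then show ?thesis
    using assms by (metis linorder_less_linear)
qed

text \<open>This is Gauss's lemma, refined by the fact that orders of vanishing at 0 add up: after
  division by the two lead coefficients, the reductions begin with the terms \<open>X^i\<close> and
  \<open>X^j\<close>, both with coefficient 1.\<close>

lemma lead_mult:
  assumes "lead f i" "lead g j"
  shows "lead (f * g) (i + j)"
    and "\<exists>u\<in>V - nonunits. coeff (f * g) (i + j) = coeff f i * coeff g j * u"
proof -
  let ?c = "coeff f i * coeff g j"
  define r where "r k l = (coeff f k / coeff f i) * (coeff g l / coeff g j)" for k l
  have c: "?c \<noteq> 0"
    using assms by (auto simp: lead_def)
  have coeff: "coeff (f * g) n / ?c = (\<Sum>k\<le>n. r k (n - k))" for n
    by (simp add: coeff_mult sum_divide_distrib r_def)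
  have rV: "r k l \<in> V" for k l
    unfolding r_def using assms by (intro mult_mem) (auto simp: lead_def)
  have rN: "r k l \<in> nonunits" if "k < i \<or> l < j" for k l
    unfolding r_def using assms that nonunits_mult by (auto simp only: lead_def)
  have V: "coeff (f * g) n / ?c \<in> V" for n
    using rV by (auto simp: coeff intro: sum_mem)
  have N: "coeff (f * g) n / ?c \<in> nonunits" if "n < i + j" for n
    unfolding coeff using that by (intro nonunits_sum rN) auto
  define u where "u = coeff (f * g) (i + j) / ?c"
  have u: "u \<in> V"
    using V by (simp add: u_def)
  \<comment> \<open>Every index other than \<open>i\<close> has \<open>k < i\<close> or
    \<open>i + j - k < j\<close>, so only \<open>r i j = 1\<close> survives modulo nonunits.\<close>
  have "u = r i j + (\<Sum>k\<in>{..i + j} - {i}. r k (i + j - k))"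
    unfolding u_def coeff by (subst sum.remove[of _ i]) auto
  moreover have "r i j = 1"
    using assms by (simp add: r_def lead_def)
  moreover have "(\<Sum>k\<in>{..i + j} - {i}. r k (i + j - k)) \<in> nonunits"
    by (intro nonunits_sum rN) auto
  ultimately have uN: "u \<notin> nonunits"
    using nonunits_diff[of u "\<Sum>k\<in>{..i + j} - {i}. r k (i + j - k)"] one_nonunits by auto
  have eq: "coeff (f * g) (i + j) = ?c * u"
    using c by (simp add: u_def)
  then show "\<exists>u\<in>V - nonunits. coeff (f * g) (i + j) = ?c * u"
    using u uN by auto
  have "u \<noteq> 0"
    using uN zero_nonunits by auto
  have "coeff (f * g) n / coeff (f * g) (i + j) = coeff (f * g) n / ?c * inverse u" for n
    by (simp add: eq field_simps)
  moreover have "coeff (f * g) n / ?c * inverse u \<in> V" for n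
    using V unit_inverse[OF u uN] by (intro mult_mem) auto
  moreover have "coeff (f * g) n / ?c * inverse u \<in> nonunits" if "n < i + j" for n
    using N[OF that] unit_inverse[OF u uN] by (intro nonunits_mult) auto
  moreover have "coeff (f * g) (i + j) \<noteq> 0"
    using c \<open>u \<noteq> 0\<close> by (simp add: eq)
  ultimately show "lead (f * g) (i + j)"
    unfolding lead_def by metis
qed

section \<open>The Gauss valuation and its refinement as relations on polynomials\<close>

text \<open>
  The fractions \<open>f / h\<close> with \<open>dominated s f h\<close> form the Gauss extension of \<open>V\<close> if \<open>s = 0\<close>; if
  \<open>s = 1\<close>, ties of the Gauss valuation are broken by the order of vanishing of the reduction at \<open>0\<close>.
\<close>

definition dominated :: "nat \<Rightarrow> 'a poly \<Rightarrow> 'a poly \<Rightarrow> bool" where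
  "dominated s f h \<longleftrightarrow> (\<exists>i. lead h i \<and> (\<forall>j. coeff f j / coeff h i \<in> V \<and>
     (s * j < s * i \<longrightarrow> coeff f j / coeff h i \<in> nonunits)))"

lemma dominated_iff:
  assumes "lead h i"
  shows "dominated s f h \<longleftrightarrow> (\<forall>j. coeff f j / coeff h i \<in> V \<and>
     (s * j < s * i \<longrightarrow> coeff f j / coeff h i \<in> nonunits))"
  unfolding dominated_def using assms lead_unique by blast

text \<open>All coefficients of \<open>f\<close> are multiples of the lead one, and those before it
  are nonunit multiples. Thus domination compares value and then index of the leads
  lexicographically; for \<open>s = 0\<close> the index condition is vacuous.\<close>

lemma dominated_lead_iff:
  assumes f: "lead f k" and h: "lead h i"
  shows "dominated s f h \<longleftrightarrow>
    coeff f k / coeff h i \<in> nonunits \<or> coeff f k / coeff h i \<in> V \<and> s * i \<le> s * k"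
proof
  assume "dominated s f h"
  then show "coeff f k / coeff h i \<in> nonunits \<or> coeff f k / coeff h i \<in> V \<and> s * i \<le> s * k"
    by (auto simp: dominated_iff[OF h] not_less[symmetric])
next
  assume R: "coeff f k / coeff h i \<in> nonunits \<or> coeff f k / coeff h i \<in> V \<and> s * i \<le> s * k"
  have eq: "coeff f j / coeff h i = coeff f j / coeff f k * (coeff f k / coeff h i)" for j
    using f by (simp add: lead_def)
  have fV: "coeff f j / coeff f k \<in> V" for j
    using f by (simp add: lead_def)
  show "dominated s f h"
    unfolding dominated_iff[OF h]
  proof (intro allI conjI impI)
    fix j
    show "coeff f j / coeff h i \<in> V"
      unfolding eq[of j] using fV R nonunits_mem by (intro mult_mem) auto
    assume "s * j < s * i"
    show "coeff f j / coeff h i \<in> nonunits"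
    proof (cases "coeff f k / coeff h i \<in> nonunits")
      case True
      then show ?thesis
        unfolding eq[of j] using fV by (intro nonunits_mult)
    next
      case False
      with R have "s * i \<le> s * k" "coeff f k / coeff h i \<in> V"
        by auto
      with \<open>s * j < s * i\<close> have "s * j < s * k"
        by linarith
      then have "j < k"
        by simp
      then have "coeff f j / coeff f k \<in> nonunits"
        using f by (simp add: lead_def)
      then show ?thesis
        unfolding eq[of j] using \<open>coeff f k / coeff h i \<in> V\<close> by (intro nonunits_mult)
    qed
  qed
qed

lemma dominated_nonzero: "dominated s f h \<Longrightarrow> h \<noteq> 0"
  unfolding dominated_def using lead_nonzero by blast

lemma dominated_zero: "h \<noteq> 0 \<Longrightarrow> dominated s 0 h"
  using ex_lead[of h] by (auto simp: dominated_def zero_mem zero_nonunits)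

lemma dominated_diff:
  assumes "dominated s f h" "dominated s g h"
  shows "dominated s (f - g) h"
proof -
  obtain i where "lead h i"
    using assms by (auto simp: dominated_def)
  then show ?thesis
    using assms by (auto simp: dominated_iff diff_divide_distrib diff_mem nonunits_diff)
qed

text \<open>By \<open>lead_mult\<close>, the factor \<open>g\<close> shifts both lead indices
  equally and changes the ratio of the lead coefficients only by a unit.\<close>

lemma dominated_mult_cancel:
  assumes "g \<noteq> 0" "h \<noteq> 0"
  shows "dominated s (f * g) (h * g) \<longleftrightarrow> dominated s f h"
proof (cases "f = 0")
  case True
  then show ?thesis
    using assms by (simp add: dominated_zero)
next
  case False
  then obtain i j k where l: "lead f i" "lead g j" "lead h k"
    using ex_lead assms by metis
  obtain u v where u: "u \<in> V" "u \<notin> nonunits" "coeff (f * g) (i + j) = coeff f i * coeff g j * u"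
    and v: "v \<in> V" "v \<notin> nonunits" "coeff (h * g) (k + j) = coeff h k * coeff g j * v"
    using lead_mult(2)[OF l(1,2)] lead_mult(2)[OF l(3,2)] by auto
  have "coeff (f * g) (i + j) / coeff (h * g) (k + j) =
      coeff f i / coeff h k * u * inverse v"
    using l(2) unfolding u(3) v(3) by (simp add: lead_def field_simps)
  moreover have "x * u * inverse v \<in> nonunits \<longleftrightarrow> x \<in> nonunits"
    "x * u * inverse v \<in> V \<longleftrightarrow> x \<in> V" for x
    using nonunits_mult_unit_iff u(1,2) unit_inverse[OF v(1,2)] by metis+
  ultimately show ?thesis
    unfolding dominated_lead_iff[OF l(1,3)]
      dominated_lead_iff[OF lead_mult(1)[OF l(1,2)] lead_mult(1)[OF l(3,2)]]
    by (simp only: distrib_left add_le_cancel_right)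
qed

lemma dominated_trans:
  assumes "dominated s f g" "dominated s g h"
  shows "dominated s f h"
proof (cases "f = 0")
  case True
  then show ?thesis
    using assms dominated_nonzero dominated_zero by blast
next
  case False
  then obtain i j k where l: "lead f i" "lead g j" "lead h k"
    using ex_lead assms dominated_nonzero by metis
  have "coeff f i / coeff h k = coeff f i / coeff g j * (coeff g j / coeff h k)"
    using l by (simp add: lead_def)
  then show ?thesis
    using assms unfolding dominated_lead_iff[OF l(1,2)] dominated_lead_iff[OF l(2,3)]
      dominated_lead_iff[OF l(1,3)]
    using nonunits_mult nonunits_mem mult_mem by (metis le_trans)
qed

lemma dominated_total:
  assumes "f \<noteq> 0" "h \<noteq> 0"
  shows "dominated s f h \<or> dominated s h f"
proof -
  obtain i j where l: "lead f i" "lead h j"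
    using ex_lead assms by metis
  have nz: "coeff f i / coeff h j \<noteq> 0"
    using l by (simp add: lead_def)
  have inv: "inverse (coeff f i / coeff h j) = coeff h j / coeff f i"
    by simp
  show ?thesis
    unfolding dominated_lead_iff[OF l] dominated_lead_iff[OF l(2,1)]
    using total[OF nz] nz unfolding inv nonunits_def using inv by auto
qed

section \<open>The Gauss extension and the smaller valuation domains centred at
  \<open>a\<close>\<close>

text \<open>Substituting \<open>X + a\<close> moves the point \<open>a\<close> to 0, where
  \<open>dominated\<close> measures vanishing. For \<open>a\<close> in \<open>V\<close>,
  \<open>gauss_ext 0 a\<close> is the domain \<open>G\<close> of the introduction and
  \<open>gauss_ext 1 a\<close> is \<open>W\<^sub>a\<close>.\<close>

definition gauss_ext :: "nat \<Rightarrow> 'a \<Rightarrow> 'a poly fract set" where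
  "gauss_ext s a =
     {Fract f h | f h. dominated s (pcompose f [:a, 1:]) (pcompose h [:a, 1:])}"

lemma pcompose_shift_eq_0_iff: "pcompose f [:a, 1:] = 0 \<longleftrightarrow> f = (0 :: 'a poly)"
  by (simp add: pcompose_eq_0_iff)

lemma valuation_domain_gauss_ext: "valuation_domain (gauss_ext s a)"
  and Fract_mem_gauss_ext: "h \<noteq> 0 \<Longrightarrow> Fract f h \<in> gauss_ext s a \<longleftrightarrow>
    dominated s (pcompose f [:a, 1:]) (pcompose h [:a, 1:])"
proof -
  let ?R = "\<lambda>f h. dominated s (pcompose f [:a, 1:]) (pcompose h [:a, 1:])"
  have 1: "?R f h \<Longrightarrow> h \<noteq> 0" for f h
    using dominated_nonzero by fastforce
  have 2: "?R (f * g) (h * g) \<longleftrightarrow> ?R f h" if "g \<noteq> 0" "h \<noteq> 0" for f g h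
    using that by (simp add: pcompose_mult dominated_mult_cancel pcompose_shift_eq_0_iff)
  have 3: "?R (f - g) h" if "?R f h" "?R g h" for f g h
    using that by (simp add: pcompose_diff dominated_diff)
  have 4: "?R f h" if "?R f g" "?R g h" for f g h
    using that dominated_trans by blast
  have 5: "?R f h \<or> ?R h f" if "f \<noteq> 0" "h \<noteq> 0" for f h
    using that by (simp add: dominated_total pcompose_shift_eq_0_iff)
  note * = valuation_domain_fractions[where R = ?R, OF 1 2 3 4 5, folded gauss_ext_def]
  show "valuation_domain (gauss_ext s a)"
    by (rule *(1))
  show "h \<noteq> 0 \<Longrightarrow> Fract f h \<in> gauss_ext s a \<longleftrightarrow> ?R f h"
    by (rule *(2))
qed

lemma gauss_ext_Zar: "gauss_ext s a \<in> Zar (const_ratfun ` V)"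
proof -
  have "lead 1 0"
    by (auto simp: lead_def one_mem zero_mem)
  then have "const_ratfun c \<in> gauss_ext s a" if "c \<in> V" for c
    using that
    by (simp add: const_ratfun_def to_fract_def Fract_mem_gauss_ext dominated_iff pcompose_1
        coeff_pCons zero_mem split: nat.splits)
  then show ?thesis
    by (auto simp: Zar_def valuation_domain_gauss_ext)
qed

text \<open>This description of Gauss domination mentions only integrality and no index, so it can
  be transported along a shift of the variable.\<close>

lemma dominated_zero_iff:
  assumes "h \<noteq> 0"
  shows "dominated 0 f h \<longleftrightarrow>
    (\<forall>c. integral (smult c h) \<longrightarrow> integral (smult c f))"
proof -
  obtain i where i: "lead h i"
    using ex_lead assms by blast
  show ?thesis
  proof
    assume "dominated 0 f h"
    then have V: "coeff f j / coeff h i \<in> V" for j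
      by (simp add: dominated_iff[OF i])
    have "c * coeff f j \<in> V" if "integral (smult c h)" for c j
    proof -
      have "c * coeff h i \<in> V"
        using that by (simp add: integral_def)
      then have "c * coeff h i * (coeff f j / coeff h i) \<in> V"
        using V by (rule mult_mem)
      then show ?thesis
        using i by (simp add: lead_def)
    qed
    then show "\<forall>c. integral (smult c h) \<longrightarrow> integral (smult c f)"
      by (simp add: integral_def)
  next
    assume "\<forall>c. integral (smult c h) \<longrightarrow> integral (smult c f)"
    \<comment> \<open>The scalar to test is the inverse of the lead coefficient of
      \<open>h\<close>.\<close>
    moreover have "integral (smult (inverse (coeff h i)) h)"
      using i by (simp add: integral_def lead_def field_simps)
    ultimately have "integral (smult (inverse (coeff h i)) f)"
      by blast
    then show "dominated 0 f h"
      by (simp add: dominated_iff[OF i] integral_def field_simps)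
  qed
qed

text \<open>The shift by \<open>- a\<close> undoes the shift by \<open>a\<close>, and both have
  coefficients in \<open>V\<close>.\<close>

lemma integral_shift_iff:
  assumes "a \<in> V"
  shows "integral (pcompose f [:a, 1:]) \<longleftrightarrow> integral f"
proof
  assume "integral (pcompose f [:a, 1:])"
  then have "integral (pcompose (pcompose f [:a, 1:]) [:- a, 1:])"
    by (rule integral_pcompose)
      (use assms in \<open>auto simp: integral_pCons integral_0 one_mem uminus_mem\<close>)
  moreover have "pcompose [:a, 1:] [:- a, 1:] = [:0, 1:]"
    by (simp add: pcompose_pCons)
  ultimately show "integral f"
    by (metis pcompose_assoc pcompose_idR)
next
  assume "integral f"
  then show "integral (pcompose f [:a, 1:])"
    using assms by (intro integral_pcompose) (auto simp: integral_pCons integral_0 one_mem)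
qed

lemma dominated_zero_shift_iff:
  assumes "a \<in> V" "h \<noteq> 0"
  shows "dominated 0 (pcompose f [:a, 1:]) (pcompose h [:a, 1:]) \<longleftrightarrow> dominated 0 f h"
  using assms
  by (simp add: dominated_zero_iff pcompose_shift_eq_0_iff integral_shift_iff
      pcompose_smult[symmetric])

lemma gauss_ext_shift:
  assumes "a \<in> V"
  shows "gauss_ext 0 a = gauss_ext 0 0"
proof -
  have "x \<in> gauss_ext 0 a \<longleftrightarrow> x \<in> gauss_ext 0 0" for x
    using assms zero_mem
    by (cases x) (simp add: Fract_mem_gauss_ext dominated_zero_shift_iff)
  then show ?thesis by blast
qed

lemma gauss_ext_subset: "gauss_ext s a \<subseteq> gauss_ext 0 a"
  by (auto simp: gauss_ext_def dominated_def)

text \<open>The function \<open>1 / (X - a)\<close> has a pole at \<open>a\<close>, which makes the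
  inclusion of \<open>gauss_ext 1 a\<close> in \<open>gauss_ext 0 a\<close> strict. After the shift
  the denominator is \<open>X\<close> with lead index 1, while the numerator has its coefficient 1
  at index 0.\<close>

lemma inverse_linear_mem:
  "Fract 1 [:- a, 1:] \<in> gauss_ext 0 a" "Fract 1 [:- a, 1:] \<notin> gauss_ext 1 a"
proof -
  have "lead [:0, 1:] 1"
    by (auto simp: lead_def coeff_pCons zero_mem one_mem zero_nonunits split: nat.splits)
  moreover have "pcompose [:- a, 1:] [:a, 1:] = [:0, 1:]"
    by (simp add: pcompose_pCons)
  ultimately show "Fract 1 [:- a, 1:] \<in> gauss_ext 0 a" "Fract 1 [:- a, 1:] \<notin> gauss_ext 1 a"
    by (auto simp: Fract_mem_gauss_ext dominated_iff pcompose_1 zero_mem one_mem one_nonunits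
        intro!: exI[of _ 0])
qed

text \<open>A pole of the reduction at \<open>a\<close> must come from a zero of the normalised
  denominator. If its value at \<open>a\<close> were a unit, the shifted denominator would have lead
  index 0, no smaller index would exist, and the two domination relations would agree.\<close>

lemma separating_root:
  assumes a: "a \<in> V" and h: "lead h i"
    and mem: "Fract f h \<in> gauss_ext 0 a" "Fract f h \<notin> gauss_ext 1 a"
  shows "poly (smult (inverse (coeff h i)) h) a \<in> nonunits"
proof (rule ccontr)
  let ?f = "pcompose f [:a, 1:]" and ?h = "pcompose h [:a, 1:]"
  let ?g = "smult (inverse (coeff h i)) h"
  assume unit: "poly ?g a \<notin> nonunits"
  have hn: "h \<noteq> 0" "coeff h i \<noteq> 0"
    using h by (auto simp: lead_def)
  have "integral ?g"
    using h by (simp add: integral_def lead_def field_simps)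
  then have V: "poly ?g a \<in> V" and "integral (pcompose ?g [:a, 1:])"
    using a by (simp_all only: poly_mem integral_shift_iff)
  then have hV: "coeff ?h j / coeff h i \<in> V" for j
    by (simp add: integral_def pcompose_smult field_simps)
  \<comment> \<open>The constant coefficient after the shift is the value of \<open>h\<close> at
    \<open>a\<close>.\<close>
  have h0: "coeff ?h 0 = coeff h i * poly ?g a"
    using hn by (simp add: poly_0_coeff_0[symmetric] poly_pcompose)
  have "poly ?g a \<noteq> 0"
    using unit zero_nonunits by metis
  moreover have "coeff ?h j / coeff ?h 0 = coeff ?h j / coeff h i * inverse (poly ?g a)" for j
    using hn h0 by (simp add: field_simps)
  moreover have "coeff ?h j / coeff h i * inverse (poly ?g a) \<in> V" for j
    using hV unit_inverse[OF V unit] by (intro mult_mem) auto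
  moreover have "coeff ?h 0 \<noteq> 0"
    using hn h0 calculation(1) by (metis mult_eq_0_iff)
  ultimately have "lead ?h 0"
    unfolding lead_def by simp
  then have "dominated 0 ?f ?h \<longleftrightarrow> dominated 1 ?f ?h"
    by (simp add: dominated_iff)
  with mem show False
    by (simp add: Fract_mem_gauss_ext hn)
qed

text \<open>By \<open>separating_root\<close> such \<open>a\<close> are roots of the reduction of
  one normalised denominator. More of them than its degree would make all its coefficients nonunits,
  although the lead one equals 1.\<close>

lemma finite_separating:
  assumes "A \<subseteq> V" "\<And>a b. a \<in> A \<Longrightarrow> b \<in> A \<Longrightarrow> a \<noteq> b \<Longrightarrow> a - b \<notin> nonunits"
  shows "finite {a \<in> A. x \<in> gauss_ext 0 a \<and> x \<notin> gauss_ext 1 a}"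
    (is "finite ?S")
proof (rule ccontr)
  assume inf: "infinite ?S"
  obtain f h where x: "x = Fract f h" "h \<noteq> 0"
    by (cases x)
  obtain i where i: "lead h i"
    using ex_lead x by blast
  let ?g = "smult (inverse (coeff h i)) h"
  obtain B where B: "B \<subseteq> ?S" "finite B" "card B = Suc (degree ?g)"
    using infinite_arbitrarily_large[OF inf, of "Suc (degree ?g)"] by metis
  have "coeff ?g i \<in> nonunits"
  proof (rule coeffs_nonunits_if_many_roots)
    show "integral ?g"
      using i by (simp add: integral_def lead_def field_simps)
    show "poly ?g a \<in> nonunits" if "a \<in> B" for a
      using that B assms(1) x by (intro separating_root[OF _ i, of _ f]) auto
    show "a - b \<notin> nonunits" if "a \<in> B" "b \<in> B" "a \<noteq> b" for a b
      using that B(1) by (intro assms(2)) auto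
  qed (use B assms(1) in auto)
  then show False
    using i one_nonunits by (simp add: lead_def)
qed

end

section \<open>Contradiction by counting residues\<close>

theorem proposition5p3:
  fixes V M :: "'a::field set"
  assumes "valuation_domain V"
    and "krull_dim (ring_on V) = 1"
    and "maximalideal M (ring_on V)"
    and "uncountable (carrier (ring_on V Quot M))"
  shows "\<not> metrizable_space (Zar_cons (const_ratfun ` V))"
proof
  assume metr: "metrizable_space (Zar_cons (const_ratfun ` V))"
  interpret valuation_ring V
    by standard fact
  obtain A where A: "A \<subseteq> V" "uncountable A"
    "\<And>a b. a \<in> A \<Longrightarrow> b \<in> A \<Longrightarrow> a \<noteq> b \<Longrightarrow> a - b \<notin> nonunits"
    using ex_uncountable_incongruent assms(3,4) by metis
  obtain C where C: "countable C"
    "\<And>W. W \<in> Zar (const_ratfun ` V) \<Longrightarrow> W \<inter> C = gauss_ext 0 0 \<inter> C \<Longrightarrow> W = gauss_ext 0 0"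
    using metrizable_Zar_cons_countable_separation[OF metr gauss_ext_Zar[of 0 0]] by metis
  let ?S = "\<lambda>x. {a \<in> A. x \<in> gauss_ext 0 a \<and> x \<notin> gauss_ext 1 a}"
  \<comment> \<open>Each function in \<open>C\<close> excludes finitely many parameters, so the
    uncountable set \<open>A\<close> keeps one that no function in \<open>C\<close>
    excludes.\<close>
  have "countable (\<Union>x\<in>C. ?S x)"
    using C(1) finite_separating[OF A(1,3)] by (simp add: countable_finite)
  then obtain a where a: "a \<in> A" "\<forall>x\<in>C. x \<in> gauss_ext 0 a \<longrightarrow> x \<in> gauss_ext 1 a"
    using A(2) countable_subset[of A "\<Union>x\<in>C. ?S x"] by fastforce
  \<comment> \<open>\<open>C\<close> was chosen for the centre 0 before \<open>a\<close> was known;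
    the Gauss extension does not depend on the centre.\<close>
  have G: "gauss_ext 0 a = gauss_ext 0 0"
    using gauss_ext_shift a A(1) by blast
  have "gauss_ext 1 a \<inter> C = gauss_ext 0 0 \<inter> C"
    using a(2) gauss_ext_subset[of 1 a] unfolding G by blast
  then have "gauss_ext 1 a = gauss_ext 0 a"
    using C(2) gauss_ext_Zar G by metis
  then show False
    using inverse_linear_mem by blast
qed

end
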